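(* Let $\Delta^\ast=\{z\in\mathbb{C}:0<|z|<1\}$, and for $0<r<1$ let $A_r=\{z\in\mathbb{C}:r<|z|<1\}$. For a bounded domain $D$ let $m_D=s_D/e_D$ be the quotient of the squeezing function by the Fridman invariant of $D$. Let $\delta>0$ be such that $m_{\Delta^\ast}(z)<1$ for all $z$ with $0<|z|<\delta$, and fix $z_0\in\Delta^\ast$ with $|z_0|<\delta$. Then there exists $\epsilon>0$ with $\epsilon\le|z_0|$ such that for all $0<r<\epsilon$, $$m_{A_r}(z_0)<1.$$
   Context: $\Delta=\{z\in\mathbb{C}:|z|<1\}$ and $r\Delta=\{z\in\mathbb{C}:|z|<r\}$. For domains $D_1,D_2\subset\mathbb{C}$, $\mathcal{O}_u(D_1,D_2)$ is the set of injective holomorphic maps $D_1\to D_2$. $k_D$ is the Kobayashi (pseudo)distance on a domain $D$, normalized so that $k_\Delta(0,z)=\operatorname{artanh}|z|$: $k_D(z,w)$ is the infimum of $\sum_{j=1}^N k_\Delta(a_j,b_j)$ over all chains of holomorphic maps $f_j:\Delta\to D$ with $f_1(a_1)=z$, $f_j(b_j)=f_{j+1}(a_{j+1})$, $f_N(b_N)=w$. For $z\in D$, $r>0$, let $B_D^k(z,r)=\{w\in D:k_D(z,w)<r\}$. For a bounded domain $D\subset\mathbb{C}$ and $z\in D$, the Fridman invariant is $$e_D(z)=\sup\{\tanh(r): r>0,\ B_D^k(z,r)\subset f(\Delta)\text{ for some } f\in\mathcal{O}_u(\Delta,D)\text{ with } f(0)=z\},$$ the squeezing function is $$s_D(z)=\sup\{r>0: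 r\Delta\subset f(D)\text{ for some } f\in\mathcal{O}_u(D,\Delta)\text{ with } f(z)=0\},$$ both take values in $(0,1]$, and $m_D(z)=s_D(z)/e_D(z)$. A number $\delta>0$ with the property required in the claim exists. *)

theory Defs
  imports "HOL-Complex_Analysis.Complex_Analysis"
begin

abbreviation unit_disc :: "complex set" where
  "unit_disc \<equiv> ball 0 1"

definition punctured_disc :: "complex set" where
  "punctured_disc = {z. 0 < cmod z \<and> cmod z < 1}"

definition annulus :: "real \<Rightarrow> complex set" where
  "annulus r = {z. r < cmod z \<and> cmod z < 1}"

definition univalent_maps :: "complex set \<Rightarrow> complex set \<Rightarrow> (complex \<Rightarrow> complex) set" where
  "univalent_maps D1 D2 = {f. f holomorphic_on D1 \<and> inj_on f D1 \<and> f ` D1 \<subseteq> D2}"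

text \<open>The Poincare distance of the unit disc, in the normalization \<open>k(0, z) = artanh |z|\<close>.
  It is used for points of the disc only.\<close>

definition disc_dist :: "complex \<Rightarrow> complex \<Rightarrow> real" where
  "disc_dist a b = artanh (cmod ((b - a) / (1 - cnj a * b)))"

lemma disc_dist_0: "disc_dist 0 z = artanh (cmod z)"
  by (simp add: disc_dist_def)

definition disc_chain ::
  "complex set \<Rightarrow> complex \<Rightarrow> complex \<Rightarrow> nat \<Rightarrow> (nat \<Rightarrow> complex \<Rightarrow> complex)
     \<Rightarrow> (nat \<Rightarrow> complex) \<Rightarrow> (nat \<Rightarrow> complex) \<Rightarrow> bool" where
  "disc_chain D z w N f a b \<longleftrightarrow>
     N \<ge> 1 \<and>
     (\<forall>j\<in>{1..N}. f j holomorphic_on unit_disc \<and> f j ` unit_disc \<subseteq> D \<and>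
                 a j \<in> unit_disc \<and> b j \<in> unit_disc) \<and>
     f 1 (a 1) = z \<and>
     (\<forall>j\<in>{1..<N}. f j (b j) = f (j + 1) (a (j + 1))) \<and>
     f N (b N) = w"

text \<open>The infima and suprema below are taken in the reals. For a bounded domain \<open>D\<close> and points
  of \<open>D\<close>, the sets involved are nonempty and bounded on the relevant side, so that these are the
  true infima and suprema; outside this case the values carry no meaning.\<close>

definition kobayashi_dist :: "complex set \<Rightarrow> complex \<Rightarrow> complex \<Rightarrow> real" where
  "kobayashi_dist D z w =
     Inf {\<Sum>j=1..N. disc_dist (a j) (b j) | N f a b. disc_chain D z w N f a b}"

definition kobayashi_ball :: "complex set \<Rightarrow> complex \<Rightarrow> real \<Rightarrow> complex set" where
  "kobayashi_ball D z r = {w \<in> D. kobayashi_dist D z w < r}"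

definition fridman_invariant :: "complex set \<Rightarrow> complex \<Rightarrow> real" where
  "fridman_invariant D z =
     Sup {tanh r | r. r > 0 \<and>
       (\<exists>f \<in> univalent_maps unit_disc D. f 0 = z \<and> kobayashi_ball D z r \<subseteq> f ` unit_disc)}"

definition squeezing_function :: "complex set \<Rightarrow> complex \<Rightarrow> real" where
  "squeezing_function D z =
     Sup {r. r > 0 \<and> (\<exists>f \<in> univalent_maps D unit_disc. f z = 0 \<and> ball 0 r \<subseteq> f ` D)}"

definition quotient_invariant :: "complex set \<Rightarrow> complex \<Rightarrow> real" where
  "quotient_invariant D z = squeezing_function D z / fridman_invariant D z"

end

theory Submission
  imports Defs
begin

text \<open>As \<open>r\<close> decreases to \<open>0\<close>, the upper limit of \<open>s\<close> and the lower limit of \<open>e\<close> on the annuli compare with their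
  values on the punctured disc. For \<open>s\<close>, a sequence of competitors on shrinking inner radii has a
  univalent limit on the punctured disc, by Montel and Hurwitz. For \<open>e\<close>, Kobayashi balls of the
  punctured disc are relatively compact, so a competitor \<open>f\<close> for the radius \<open>R\<close> may be replaced, at
  the cost of a slightly smaller radius, by \<open>f (t \<cdot> z)\<close> with \<open>t < 1\<close>; its image stays away from \<open>0\<close>,
  hence lies in every annulus with small inner radius.\<close>

section \<open>Chains of discs\<close>

text \<open>The quotient is, up to a unimodular factor, the image of \<open>b\<close> under the disc
  automorphism sending \<open>a\<close> to 0; hence \<open>artanh\<close> in
  \<open>disc_dist\<close> is applied within its domain.\<close>

lemma disc_pseudo_dist_less_1:
  assumes "a \<in> unit_disc" "b \<in> unit_disc"
  shows "cmod ((b - a) / (1 - cnj a * b)) < 1"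
  using Moebius_function_norm_lt_1[of a b 0] assms by (simp add: Moebius_function_simple)

text \<open>Only the term \<open>- ln (1 - x)\<close> is estimated, so the constant is not sharp;
  any linear lower bound will do below.\<close>

lemma half_le_artanh:
  fixes x :: real
  assumes "0 \<le> x" "x < 1"
  shows "x / 2 \<le> artanh x"
proof -
  have "ln (1 - x) \<le> 0 - x"
    using ln_add_one_self_le_self2[of "- x"] assms by simp
  moreover have "0 \<le> ln (1 + x)"
    using assms by simp
  moreover have "artanh x = (ln (1 + x) - ln (1 - x)) / 2"
    using assms by (simp add: artanh_def ln_div)
  ultimately show ?thesis
    by argo
qed

lemma disc_dist_nonneg:
  assumes "a \<in> unit_disc" "b \<in> unit_disc"
  shows "0 \<le> disc_dist a b"
  using half_le_artanh[OF norm_ge_zero disc_pseudo_dist_less_1[OF assms]]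
    norm_ge_zero[of "(b - a) / (1 - cnj a * b)"]
  unfolding disc_dist_def by linarith

lemma disc_chain_sum_nonneg:
  assumes "disc_chain D z w N f a b"
  shows "0 \<le> (\<Sum>j=1..N. disc_dist (a j) (b j))"
  using assms by (intro sum_nonneg disc_dist_nonneg) (auto simp: disc_chain_def)

lemma bdd_below_chain_sums:
  "bdd_below {\<Sum>j=1..N. disc_dist (a j) (b j) | N f a b. disc_chain D z w N f a b}"
  using disc_chain_sum_nonneg by (intro bdd_belowI[of _ 0]) blast

lemma kobayashi_dist_le_chain_sum:
  assumes "disc_chain D z w N f a b"
  shows "kobayashi_dist D z w \<le> (\<Sum>j=1..N. disc_dist (a j) (b j))"
  unfolding kobayashi_dist_def
  by (rule cInf_lower[OF _ bdd_below_chain_sums]) (use assms in blast)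

lemma disc_chain_mono:
  assumes "disc_chain D z w N f a b" "D \<subseteq> D'"
  shows "disc_chain D' z w N f a b"
  using assms unfolding disc_chain_def by blast

text \<open>A round disc inside \<open>D\<close> has an affine parametrisation, which alone links
  any two of its points.\<close>

lemma disc_chain_affine:
  assumes "ball c e \<subseteq> D" "w \<in> ball c e" "v \<in> ball c e"
  shows "disc_chain D w v 1 (\<lambda>_ \<zeta>. c + of_real e * \<zeta>) (\<lambda>_. (w - c) / of_real e) (\<lambda>_. (v - c) / of_real e)"
proof -
  have e: "e > 0" using assms(2) by (metis mem_ball dist_not_less_zero linorder_not_less order_less_le_trans)
  have "(\<lambda>\<zeta>. c + of_real e * \<zeta>) ` unit_disc \<subseteq> ball c e"
    using e by (auto simp: dist_norm norm_mult)
  moreover have "(x - c) / of_real e \<in> unit_disc" if "x \<in> ball c e" for x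
    using that e by (simp add: norm_divide dist_norm norm_minus_commute)
  ultimately show ?thesis
    using assms e by (auto simp: disc_chain_def intro!: holomorphic_intros)
qed

lemma disc_chain_extend:
  assumes ch: "disc_chain D z w N f a b" and sub: "ball c e \<subseteq> D" and wv: "w \<in> ball c e" "v \<in> ball c e"
  shows "disc_chain D z v (Suc N) (f(Suc N := \<lambda>\<zeta>. c + of_real e * \<zeta>))
           (a(Suc N := (w - c) / of_real e)) (b(Suc N := (v - c) / of_real e))"
proof -
  note A = disc_chain_affine[OF sub wv]
  have N: "N \<ge> 1" using ch by (simp add: disc_chain_def)
  have split1: "{1..Suc N} = insert (Suc N) {1..N}" "{1..<Suc N} = insert N {1..<N}"
    using N by auto
  show ?thesis
    using ch A N unfolding disc_chain_def split1 by auto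
qed

text \<open>Reachability by chains spreads over every ball inside \<open>D\<close>, hence over the
  connected set \<open>D\<close>. With \<open>bdd_below_chain_sums\<close> this makes the infimum in
  \<open>kobayashi_dist\<close> a genuine one.\<close>

lemma disc_chain_exists:
  assumes "open D" "connected D" "z \<in> D" "w \<in> D"
  shows "\<exists>N f a b. disc_chain D z w N f a b"
proof (rule connected_induction_simple[OF assms(2,3,4)])
  obtain e where "e > 0" "ball z e \<subseteq> D"
    using assms open_contains_ball by blast
  then show "\<exists>N f a b. disc_chain D z z N f a b"
    using disc_chain_affine[of z e D z z] by auto
next
  fix c assume "c \<in> D"
  then obtain e where e: "e > 0" "ball c e \<subseteq> D"
    using assms open_contains_ball by blast
  show "\<exists>T. openin (top_of_set D) T \<and> c \<in> T \<and>
          (\<forall>x\<in>T. \<forall>y\<in>T. (\<exists>N f a b. disc_chain D z x N f a b) \<longrightarrow> (\<exists>N f a b. disc_chain D z y N f a b))"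
  proof (intro exI[of _ "ball c e"] conjI ballI impI)
    show "openin (top_of_set D) (ball c e)"
      using e by (simp add: openin_open_eq assms(1))
  qed (use e disc_chain_extend[OF _ e(2)] in \<open>auto, blast\<close>)
qed

lemma kobayashi_dist_less_chain:
  assumes "open D" "connected D" "z \<in> D" "w \<in> D" "kobayashi_dist D z w < R"
  obtains N f a b where "disc_chain D z w N f a b" "(\<Sum>j=1..N. disc_dist (a j) (b j)) < R"
proof -
  have "{\<Sum>j=1..N. disc_dist (a j) (b j) | N f a b. disc_chain D z w N f a b} \<noteq> {}"
    using disc_chain_exists[OF assms(1-4)] by blast
  from cInf_lessD[OF this assms(5)[unfolded kobayashi_dist_def]] that show ?thesis
    by blast
qed

text \<open>Chains in \<open>D'\<close> are chains in \<open>D\<close>, so the infimum for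
  \<open>D\<close> runs over a larger set. The assumptions on \<open>D'\<close> make the smaller set
  nonempty.\<close>

lemma kobayashi_dist_antimono:
  assumes "D' \<subseteq> D" "open D'" "connected D'" "z \<in> D'" "w \<in> D'"
  shows "kobayashi_dist D z w \<le> kobayashi_dist D' z w"
  unfolding kobayashi_dist_def
proof (rule cInf_superset_mono[OF _ bdd_below_chain_sums])
  show "{\<Sum>j=1..N. disc_dist (a j) (b j) | N f a b. disc_chain D' z w N f a b} \<noteq> {}"
    using disc_chain_exists[OF assms(2-5)] by blast
  show "{\<Sum>j=1..N. disc_dist (a j) (b j) | N f a b. disc_chain D' z w N f a b}
      \<subseteq> {\<Sum>j=1..N. disc_dist (a j) (b j) | N f a b. disc_chain D z w N f a b}"
    using disc_chain_mono[OF _ assms(1)] by blast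
qed

lemma kobayashi_ball_mono:
  assumes "D' \<subseteq> D" "open D'" "connected D'" "z \<in> D'"
  shows "kobayashi_ball D' z R \<subseteq> kobayashi_ball D z R"
proof
  fix w assume w: "w \<in> kobayashi_ball D' z R"
  then have "kobayashi_dist D z w \<le> kobayashi_dist D' z w"
    using kobayashi_dist_antimono[OF assms] by (simp add: kobayashi_ball_def)
  with w assms(1) show "w \<in> kobayashi_ball D z R"
    by (auto simp: kobayashi_ball_def)
qed

text \<open>A near-optimal chain to \<open>w\<close> is prolonged by one affine disc onto
  \<open>ball v e\<close>. Its centre is the new endpoint, so the added length is explicit.\<close>

lemma kobayashi_dist_triangle_ball:
  assumes "open D" "connected D" "z \<in> D" "ball v e \<subseteq> D" "w \<in> ball v e"
  shows "kobayashi_dist D z v \<le> kobayashi_dist D z w + artanh (dist w v / e)"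
proof (rule field_le_epsilon)
  fix d :: real assume d: "d > 0"
  have e: "e > 0" using assms(5) by (metis mem_ball dist_not_less_zero linorder_not_less order_less_le_trans)
  have wD: "w \<in> D" using assms by blast
  have "kobayashi_dist D z w < kobayashi_dist D z w + d" using d by simp
  then obtain N f a b where ch: "disc_chain D z w N f a b"
    and s: "(\<Sum>j=1..N. disc_dist (a j) (b j)) < kobayashi_dist D z w + d"
    using kobayashi_dist_less_chain[OF assms(1-3) wD] by metis
  have N: "N \<ge> 1" using ch by (simp add: disc_chain_def)
  define a' b' where "a' = a(Suc N := (w - v) / of_real e)" and "b' = b(Suc N := (v - v) / of_real e)"
  have "kobayashi_dist D z v \<le> (\<Sum>j=1..Suc N. disc_dist (a' j) (b' j))"
    unfolding a'_def b'_def
    by (rule kobayashi_dist_le_chain_sum[OF disc_chain_extend[OF ch assms(4,5)]]) (use e in simp)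
  also have "\<dots> = (\<Sum>j=1..N. disc_dist (a' j) (b' j)) + disc_dist ((w - v) / of_real e) 0"
    by (simp add: a'_def b'_def)
  also have "(\<Sum>j=1..N. disc_dist (a' j) (b' j)) = (\<Sum>j=1..N. disc_dist (a j) (b j))"
    by (rule sum.cong) (auto simp: a'_def b'_def)
  also have "disc_dist ((w - v) / of_real e) 0 = artanh (dist w v / e)"
    using e by (simp add: disc_dist_def norm_divide dist_norm norm_minus_commute)
  finally show "kobayashi_dist D z v \<le> kobayashi_dist D z w + artanh (dist w v / e) + d"
    using s by linarith
qed

text \<open>Triangle inequality along the nodes of the chain. The map \<open>u\<close> changes the
  metric: it will be the identity, or \<open>ln (- ln (cmod w))\<close> on the punctured
  disc.\<close>

lemma disc_chain_dist_le:
  fixes u :: "complex \<Rightarrow> 'a::metric_space"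
  assumes lip: "\<And>\<phi> a b. \<phi> holomorphic_on unit_disc \<Longrightarrow> \<phi> ` unit_disc \<subseteq> D \<Longrightarrow> a \<in> unit_disc \<Longrightarrow>
      b \<in> unit_disc \<Longrightarrow> dist (u (\<phi> a)) (u (\<phi> b)) \<le> C * disc_dist a b"
    and ch: "disc_chain D z w N f a b"
  shows "dist (u z) (u w) \<le> C * (\<Sum>j=1..N. disc_dist (a j) (b j))"
proof -
  have step: "dist (u (f j (a j))) (u (f j (b j))) \<le> C * disc_dist (a j) (b j)" if "j \<in> {1..N}" for j
    using ch that by (intro lip) (auto simp: disc_chain_def)
  have "Suc m \<le> N \<Longrightarrow> dist (u z) (u (f (Suc m) (b (Suc m)))) \<le> C * (\<Sum>j=1..Suc m. disc_dist (a j) (b j))" for m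
  proof (induction m)
    case 0
    then show ?case using step[of 1] ch by (simp add: disc_chain_def)
  next
    case (Suc m)
    have "f (Suc m) (b (Suc m)) = f (Suc (Suc m)) (a (Suc (Suc m)))"
      using ch Suc.prems by (auto simp: disc_chain_def)
    then have "dist (u z) (u (f (Suc (Suc m)) (b (Suc (Suc m)))))
        \<le> dist (u z) (u (f (Suc m) (b (Suc m)))) + C * disc_dist (a (Suc (Suc m))) (b (Suc (Suc m)))"
      using step[of "Suc (Suc m)"] Suc.prems
        dist_triangle[of "u z" "u (f (Suc (Suc m)) (b (Suc (Suc m))))" "u (f (Suc m) (b (Suc m)))"]
      by (simp del: sum.cl_ivl_Suc)
    then show ?case using Suc by (simp add: algebra_simps)
  qed
  from this[of "N - 1"] show ?thesis
    using ch by (simp add: disc_chain_def)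
qed

lemma kobayashi_ball_dist_less:
  fixes u :: "complex \<Rightarrow> 'a::metric_space"
  assumes lip: "\<And>\<phi> a b. \<phi> holomorphic_on unit_disc \<Longrightarrow> \<phi> ` unit_disc \<subseteq> D \<Longrightarrow> a \<in> unit_disc \<Longrightarrow>
      b \<in> unit_disc \<Longrightarrow> dist (u (\<phi> a)) (u (\<phi> b)) \<le> C * disc_dist a b"
    and D: "open D" "connected D" "z \<in> D" and C: "C > 0" and w: "w \<in> kobayashi_ball D z R"
  shows "dist (u z) (u w) < C * R"
proof -
  have "w \<in> D" "kobayashi_dist D z w < R" using w by (auto simp: kobayashi_ball_def)
  then obtain N f a b where ch: "disc_chain D z w N f a b" and s: "(\<Sum>j=1..N. disc_dist (a j) (b j)) < R"
    using kobayashi_dist_less_chain[OF D] by metis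
  have "dist (u z) (u w) \<le> C * (\<Sum>j=1..N. disc_dist (a j) (b j))"
    using lip ch by (rule disc_chain_dist_le)
  also have "\<dots> < C * R" using s C by simp
  finally show ?thesis .
qed

section \<open>Schwarz--Pick estimates\<close>

text \<open>Precomposing \<open>h\<close> with the automorphism that takes 0 to \<open>a\<close>
  gives a self-map of the disc fixing 0, to which the Schwarz lemma applies.\<close>

lemma Schwarz_Pick_zero:
  assumes h: "h holomorphic_on unit_disc" "h ` unit_disc \<subseteq> unit_disc" "h a = 0"
    and ab: "a \<in> unit_disc" "b \<in> unit_disc"
  shows "cmod (h b) \<le> cmod ((b - a) / (1 - cnj a * b))"
proof -
  let ?M = "Moebius_function 0"
  have "cmod (h (?M (- a) (?M a b))) \<le> cmod (?M a b)"
  proof (rule Schwarz_Lemma(1)[of "\<lambda>z. h (?M (- a) z)"])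
    show "(\<lambda>z. h (?M (- a) z)) holomorphic_on unit_disc"
    proof (rule holomorphic_on_compose_gen[OF Moebius_function_holomorphic h(1), unfolded o_def])
      show "?M (- a) ` unit_disc \<subseteq> unit_disc"
        using Moebius_function_norm_lt_1 ab by auto
    qed (use ab in simp)
    show "cmod (h (?M (- a) z)) < 1" if "cmod z < 1" for z
      using h(2) that ab Moebius_function_norm_lt_1[of "- a" z 0] by (force simp: image_subset_iff)
  qed (use h ab Moebius_function_norm_lt_1 in \<open>auto simp: Moebius_function_of_zero\<close>)
  then show ?thesis
    using ab by (simp add: Moebius_function_compose) (simp add: Moebius_function_simple)
qed

text \<open>Apply \<open>Schwarz_Pick_zero\<close> to \<open>(h z - h a) / 2\<close>. Halving keeps
  the values in the disc and costs a factor 2; \<open>half_le_artanh\<close> costs another.\<close>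

lemma dist_le_disc_dist:
  assumes h: "h holomorphic_on unit_disc" "h ` unit_disc \<subseteq> unit_disc"
    and ab: "a \<in> unit_disc" "b \<in> unit_disc"
  shows "dist (h a) (h b) \<le> 4 * disc_dist a b"
proof -
  have "cmod ((h b - h a) / 2) \<le> cmod ((b - a) / (1 - cnj a * b))"
  proof (rule Schwarz_Pick_zero[OF _ _ _ ab])
    show "(\<lambda>z. (h z - h a) / 2) holomorphic_on unit_disc"
      using h by (intro holomorphic_intros) auto
    have "cmod (h z - h a) < 2" if "cmod z < 1" for z
    proof -
      have "cmod (h z) < 1" "cmod (h a) < 1" using h(2) ab that by (auto simp: image_subset_iff)
      then show ?thesis using norm_triangle_ineq4[of "h z" "h a"] by linarith
    qed
    then show "(\<lambda>z. (h z - h a) / 2) ` unit_disc \<subseteq> unit_disc"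
      by (auto simp: norm_divide)
  qed simp
  moreover have "cmod ((b - a) / (1 - cnj a * b)) / 2 \<le> disc_dist a b"
    unfolding disc_dist_def by (rule half_le_artanh[OF norm_ge_zero disc_pseudo_dist_less_1[OF ab]])
  moreover have "cmod ((h b - h a) / 2) = dist (h a) (h b) / 2"
    by (simp add: norm_divide dist_norm norm_minus_commute)
  ultimately show ?thesis
    by linarith
qed

text \<open>The last assumption rearranges to
  \<open>y / x \<le> (1 + \<rho>) / (1 - \<rho>)\<close>, and the logarithm of the right side is
  \<open>2 * artanh \<rho>\<close>.\<close>

lemma ln_diff_le_artanh:
  fixes x y \<rho> :: real
  assumes "x > 0" "y > 0" "0 \<le> \<rho>" "\<rho> < 1" "y - x \<le> \<rho> * (y + x)"
  shows "ln y - ln x \<le> 2 * artanh \<rho>"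
proof -
  have "ln y - ln x = ln (y / x)" using assms by (simp add: ln_div)
  also have "\<dots> \<le> ln ((1 + \<rho>) / (1 - \<rho>))"
    using assms by (intro ln_mono) (auto simp: field_simps)
  finally show ?thesis by (simp add: artanh_def)
qed

text \<open>This modulus is the pseudo-hyperbolic distance of the left half-plane. The last
  inequality says that projecting both points to the real axis does not increase it.\<close>

lemma left_half_plane_ratio:
  assumes "Re p < 0" "Re q < 0"
  shows "p + cnj q \<noteq> 0" "cmod ((p - q) / (p + cnj q)) < 1"
    "\<bar>Re p - Re q\<bar> \<le> cmod ((p - q) / (p + cnj q)) * \<bar>Re p + Re q\<bar>"
proof -
  show nz: "p + cnj q \<noteq> 0"
    using assms by (auto simp: complex_eq_iff)
  have pos: "cmod (p + cnj q) > 0" using nz by simp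
  let ?d = "Im p - Im q"
  have n1: "(cmod (p - q))\<^sup>2 = (Re p - Re q)\<^sup>2 + ?d\<^sup>2"
    and n2: "(cmod (p + cnj q))\<^sup>2 = (Re p + Re q)\<^sup>2 + ?d\<^sup>2"
    by (simp_all add: cmod_power2)
  have "Re p * Re q > 0" using assms by (simp add: mult_neg_neg)
  then have lt: "(Re p - Re q)\<^sup>2 < (Re p + Re q)\<^sup>2"
    by (simp add: power2_eq_square algebra_simps)
  then have "(cmod (p - q))\<^sup>2 < (cmod (p + cnj q))\<^sup>2"
    using n1 n2 by simp
  then have "cmod (p - q) < cmod (p + cnj q)"
    by (rule power2_less_imp_less) simp
  then show "cmod ((p - q) / (p + cnj q)) < 1"
    using pos by (simp add: norm_divide)
  \<comment> \<open>Expanding both squares, the product of the two real squares cancels; what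
    remains is \<open>lt\<close> times \<open>?d\<^sup>2\<close>.\<close>
  have "(\<bar>Re p - Re q\<bar> * cmod (p + cnj q))\<^sup>2 \<le> (cmod (p - q) * \<bar>Re p + Re q\<bar>)\<^sup>2"
  proof -
    have "(Re p - Re q)\<^sup>2 * ?d\<^sup>2 \<le> (Re p + Re q)\<^sup>2 * ?d\<^sup>2"
      using lt by (intro mult_right_mono) auto
    then show ?thesis by (simp add: power_mult_distrib n1 n2 algebra_simps)
  qed
  then have "\<bar>Re p - Re q\<bar> * cmod (p + cnj q) \<le> cmod (p - q) * \<bar>Re p + Re q\<bar>"
    by (rule power2_le_imp_le) simp
  then show "\<bar>Re p - Re q\<bar> \<le> cmod ((p - q) / (p + cnj q)) * \<bar>Re p + Re q\<bar>"
    using pos by (simp add: norm_divide field_simps)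
qed

text \<open>A map into the punctured disc lifts through \<open>exp\<close> to the left half-plane, where Schwarz--Pick
  turns into Harnack's inequality for \<open>- ln \<bar>h\<bar>\<close>.\<close>

lemma dist_ln_ln_le_disc_dist:
  assumes h: "h holomorphic_on unit_disc" "h ` unit_disc \<subseteq> punctured_disc"
    and ab: "a \<in> unit_disc" "b \<in> unit_disc"
  shows "dist (ln (- ln (cmod (h a)))) (ln (- ln (cmod (h b)))) \<le> 2 * disc_dist a b"
proof -
  have hz: "0 < cmod (h z)" "cmod (h z) < 1" if "z \<in> unit_disc" for z
  proof -
    have "h z \<in> punctured_disc" using h(2) that by blast
    then show "0 < cmod (h z)" "cmod (h z) < 1" by (auto simp: punctured_disc_def)
  qed
  obtain g where g: "g holomorphic_on unit_disc" "\<And>z. z \<in> unit_disc \<Longrightarrow> h z = exp (g z)"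
    using contractible_imp_holomorphic_log[OF h(1)] hz
    by (metis convex_ball convex_imp_contractible norm_zero order_less_irrefl)
  have Re_g: "Re (g z) = ln (cmod (h z))" if "z \<in> unit_disc" for z
    using g(2)[OF that] by simp
  have neg: "Re (g z) < 0" if "z \<in> unit_disc" for z
    using Re_g[OF that] hz[OF that] by simp
  let ?\<rho> = "cmod ((b - a) / (1 - cnj a * b))"
  \<comment> \<open>The quotient is the Cayley map of the half-plane that sends \<open>g a\<close>
    to 0, composed with \<open>g\<close>: a self-map of the disc vanishing at
    \<open>a\<close>.\<close>
  have "cmod ((g b - g a) / (g b + cnj (g a))) \<le> ?\<rho>"
  proof (rule Schwarz_Pick_zero[OF _ _ _ ab])
    show "(\<lambda>z. (g z - g a) / (g z + cnj (g a))) holomorphic_on unit_disc"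
      using g(1) left_half_plane_ratio(1)[OF neg neg] ab by (intro holomorphic_intros) auto
    show "(\<lambda>z. (g z - g a) / (g z + cnj (g a))) ` unit_disc \<subseteq> unit_disc"
      using left_half_plane_ratio(2)[OF neg neg] ab by auto
  qed simp
  moreover have "\<bar>Re (g b) - Re (g a)\<bar>
      \<le> cmod ((g b - g a) / (g b + cnj (g a))) * \<bar>Re (g b) + Re (g a)\<bar>"
    by (rule left_half_plane_ratio(3)[OF neg[OF ab(2)] neg[OF ab(1)]])
  ultimately have "\<bar>Re (g b) - Re (g a)\<bar> \<le> ?\<rho> * \<bar>Re (g b) + Re (g a)\<bar>"
    by (meson abs_ge_zero mult_right_mono order_trans)
  moreover have "\<bar>Re (g b) + Re (g a)\<bar> = - Re (g b) - Re (g a)"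
    using neg[OF ab(1)] neg[OF ab(2)] by simp
  ultimately have *: "\<bar>Re (g b) - Re (g a)\<bar> \<le> ?\<rho> * (- Re (g b) - Re (g a))"
    by (simp only:)
  have "ln (- Re (g b)) - ln (- Re (g a)) \<le> 2 * artanh ?\<rho>"
    by (rule ln_diff_le_artanh[OF _ _ norm_ge_zero disc_pseudo_dist_less_1[OF ab]])
       (use * neg ab in \<open>auto simp: algebra_simps\<close>)
  moreover have "ln (- Re (g a)) - ln (- Re (g b)) \<le> 2 * artanh ?\<rho>"
    by (rule ln_diff_le_artanh[OF _ _ norm_ge_zero disc_pseudo_dist_less_1[OF ab]])
       (use * neg ab in \<open>auto simp: algebra_simps\<close>)
  ultimately show ?thesis
    using ab by (simp add: Re_g dist_real_def disc_dist_def)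
qed

section \<open>Normal families on exhaustions\<close>

text \<open>Montel's theorem on each \<open>S i\<close>, followed by a diagonal choice of
  subsequence. This form allows the domain of \<open>F n\<close> to grow with
  \<open>n\<close>.\<close>

lemma Montel_exhaustion:
  fixes F :: "nat \<Rightarrow> complex \<Rightarrow> complex" and S :: "nat \<Rightarrow> complex set"
  assumes S: "\<And>n. open (S n)" "incseq S"
    and F: "\<And>n. F n holomorphic_on S n" "\<And>n z. z \<in> S n \<Longrightarrow> cmod (F n z) \<le> B"
  obtains g r where "strict_mono (r :: nat \<Rightarrow> nat)" "g holomorphic_on (\<Union>n. S n)"
    "\<And>i K. compact K \<Longrightarrow> K \<subseteq> S i \<Longrightarrow> uniform_limit K (F \<circ> r) g sequentially"
proof -
  have mono: "S i \<subseteq> S n" if "i \<le> n" for i n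
    using S(2) that by (simp add: incseq_def)
  \<comment> \<open>On \<open>S i\<close> only the terms with \<open>i \<le> n\<close> are known to
    be holomorphic; the finitely many earlier ones become 0, so that Montel applies to a full
    sequence.\<close>
  define G where "G i n = (if i \<le> n then F n else (\<lambda>_. 0))" for i n
  define P where "P i r \<longleftrightarrow> (\<exists>g. g holomorphic_on S i \<and>
      (\<forall>K. compact K \<and> K \<subseteq> S i \<longrightarrow> uniform_limit K (G i \<circ> r) g sequentially))" for i and r :: "nat \<Rightarrow> nat"
  have G: "G i n holomorphic_on S i" "z \<in> S i \<Longrightarrow> cmod (G i n z) \<le> \<bar>B\<bar>" for i n z
  proof -
    show "G i n holomorphic_on S i"
      using holomorphic_on_subset[OF F(1) mono] by (simp add: G_def)
    show "cmod (G i n z) \<le> \<bar>B\<bar>" if z: "z \<in> S i"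
    proof (cases "i \<le> n")
      case True
      then have "cmod (F n z) \<le> B" using F(2) mono z by blast
      then show ?thesis using True by (simp add: G_def)
    qed (simp add: G_def)
  qed
  obtain r where r: "strict_mono (r :: nat \<Rightarrow> nat)" and Pr: "\<And>i. P i (id \<circ> r)"
  proof (rule subsequence_diagonalization_lemma[of P id])
    fix i and r :: "nat \<Rightarrow> nat"
    obtain g k where "g holomorphic_on S i" "strict_mono (k :: nat \<Rightarrow> nat)"
      "\<And>K. compact K \<Longrightarrow> K \<subseteq> S i \<Longrightarrow> uniform_limit K ((\<lambda>n. G i (r n)) \<circ> k) g sequentially"
    proof (rule Montel[of "S i" "range (G i)" "\<lambda>n. G i (r n)"])
      show "\<exists>B. \<forall>h\<in>range (G i). \<forall>z\<in>K. cmod (h z) \<le> B" if "K \<subseteq> S i" for K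
        using G(2) that by blast
    qed (use S G in auto)
    then show "\<exists>k. strict_mono k \<and> P i (r \<circ> k)"
      unfolding P_def comp_def by blast
  next
    \<comment> \<open>Convergence passes to \<open>k2\<close>, whose tail is drawn from
      \<open>k1\<close> at indices at least as late.\<close>
    fix i and r k1 k2 :: "nat \<Rightarrow> nat" and N
    assume P1: "P i (r \<circ> k1)" and sub: "\<And>j. N \<le> j \<Longrightarrow> \<exists>j'\<ge>j. k2 j = k1 j'"
    have "uniform_limit K (G i \<circ> (r \<circ> k2)) g sequentially"
      if lim1: "uniform_limit K (G i \<circ> (r \<circ> k1)) g sequentially" for K g
      unfolding uniform_limit_sequentially_iff
    proof (intro allI impI)
      fix e :: real assume "e > 0"
      then obtain M where M: "\<And>n x. n \<ge> M \<Longrightarrow> x \<in> K \<Longrightarrow> dist ((G i \<circ> (r \<circ> k1)) n x) (g x) < e"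
        using lim1 unfolding uniform_limit_sequentially_iff by blast
      show "\<exists>M. \<forall>n\<ge>M. \<forall>x\<in>K. dist ((G i \<circ> (r \<circ> k2)) n x) (g x) < e"
      proof (intro exI[of _ "max M N"] allI impI ballI)
        fix n x assume n: "max M N \<le> n" and x: "x \<in> K"
        then obtain j where "j \<ge> n" "k2 n = k1 j" using sub[of n] by auto
        then show "dist ((G i \<circ> (r \<circ> k2)) n x) (g x) < e"
          using M[of j x] n x by simp
      qed
    qed
    then show "P i (r \<circ> k2)"
      using P1 unfolding P_def by blast
  qed blast
  then obtain h where h: "\<And>i. h i holomorphic_on S i"
    "\<And>i K. compact K \<Longrightarrow> K \<subseteq> S i \<Longrightarrow> uniform_limit K (G i \<circ> r) (h i) sequentially"
    unfolding P_def id_comp by metis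
  have ev: "\<forall>\<^sub>F n in sequentially. G i (r n) = F (r n)" for i
    using eventually_ge_at_top[of i]
  proof eventually_elim
    case (elim n)
    then have "i \<le> r n" using seq_suble[OF r, of n] by linarith
    then show ?case by (simp add: G_def)
  qed
  have lim: "uniform_limit K (F \<circ> r) (h i) sequentially" if "compact K" "K \<subseteq> S i" for i K
  proof -
    have "\<forall>\<^sub>F n in sequentially. \<forall>x\<in>K. (G i \<circ> r) n x = (F \<circ> r) n x"
      using ev[of i] by eventually_elim simp
    from uniform_limit_cong[OF this refl] h(2)[OF that] show ?thesis
      by blast
  qed
  \<comment> \<open>The limits \<open>h i\<close> glue, each being the pointwise limit of the same
    sequence.\<close>
  define g where "g z = lim (\<lambda>n. F (r n) z)" for z
  have gh: "g z = h i z" if "z \<in> S i" for z i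
    unfolding g_def using tendsto_uniform_limitI[OF lim[of "{z}" i], of z] that by (simp add: limI)
  show thesis
  proof (rule that[OF r])
    have "g holomorphic_on S i" for i
      using h(1)[of i] gh by (simp cong: holomorphic_cong)
    then show "g holomorphic_on (\<Union>n. S n)"
      using S(1) by (intro holomorphic_on_UN_open)
    show "uniform_limit K (F \<circ> r) g sequentially" if K: "compact K" "K \<subseteq> S i" for i K
    proof -
      have "uniform_limit K (F \<circ> r) g sequentially \<longleftrightarrow> uniform_limit K (F \<circ> r) (h i) sequentially"
        using K gh by (intro uniform_limit_cong') auto
      then show ?thesis using lim[OF K] by simp
    qed
  qed
qed

text \<open>Needed to pass to the limit in \<open>f n (g n w) = w\<close>, where the inner points
  move with \<open>n\<close>.\<close>

lemma uniform_limit_tendsto_compose: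
  fixes F :: "nat \<Rightarrow> complex \<Rightarrow> complex"
  assumes "open U" "x \<in> U" "continuous_on U f" "y \<longlonglongrightarrow> x"
    and "\<And>K. compact K \<Longrightarrow> K \<subseteq> U \<Longrightarrow> uniform_limit K F f sequentially"
  shows "(\<lambda>n. F n (y n)) \<longlonglongrightarrow> f x"
proof -
  obtain e where e: "e > 0" "cball x e \<subseteq> U"
    using assms open_contains_cball by blast
  have ul: "uniform_limit (cball x e) F f sequentially"
    using assms(5)[OF compact_cball e(2)] .
  have ev: "\<forall>\<^sub>F n in sequentially. y n \<in> cball x e"
    using tendstoD[OF assms(4) e(1)] by eventually_elim (simp add: dist_commute)
  have "(\<lambda>n. f (y n)) \<longlonglongrightarrow> f x"
    using isCont_tendsto_compose[OF _ assms(4)] continuous_on_eq_continuous_at[OF assms(1)] assms(2,3) by metis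
  moreover have "(\<lambda>n. F n (y n) - f (y n)) \<longlonglongrightarrow> 0"
  proof (rule tendstoI)
    fix d :: real assume "d > 0"
    from uniform_limitD[OF ul this] ev
    show "\<forall>\<^sub>F n in sequentially. dist (F n (y n) - f (y n)) 0 < d"
      by eventually_elim (simp add: dist_norm)
  qed
  ultimately have "(\<lambda>n. (F n (y n) - f (y n)) + f (y n)) \<longlonglongrightarrow> 0 + f x"
    by (intro tendsto_add)
  then show ?thesis by simp
qed

text \<open>By the open mapping theorem the image is open, so it lies in the interior of the closed
  disc.\<close>

lemma holomorphic_image_in_open_disc:
  fixes f :: "complex \<Rightarrow> complex"
  assumes "f holomorphic_on U" "open U" "connected U" "\<not> f constant_on U" "f ` U \<subseteq> cball 0 1"
  shows "f ` U \<subseteq> unit_disc"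
  using open_mapping_thm[OF assms(1-3) assms(2) subset_refl assms(4)] interior_maximal[OF assms(5)]
  by simp

text \<open>The maps and their inverses on \<open>ball 0 s\<close> converge along a subsequence; the relation
  \<open>f (g w) = w\<close> passes to the limit near \<open>0\<close> and keeps both limits from being constant.\<close>

lemma univalent_limit:
  fixes A E :: "nat \<Rightarrow> complex set" and f :: "nat \<Rightarrow> complex \<Rightarrow> complex"
  assumes A: "\<And>n. open (A n)" "\<And>n. connected (A n)" "incseq A" "p \<in> A 0"
    and D: "D = (\<Union>n. A n)" "D \<subseteq> unit_disc"
    and E: "\<And>n. open (E n)" "\<And>n. A n \<subseteq> E n" "\<And>n. E n \<subseteq> D"
    and f: "\<And>n. f n \<in> univalent_maps (E n) unit_disc" "\<And>n. f n p = 0" "\<And>n. ball 0 s \<subseteq> f n ` E n"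
    and s: "s > 0"
  shows "\<exists>F \<in> univalent_maps D unit_disc. F p = 0 \<and> ball 0 s \<subseteq> F ` D"
proof -
  have mono: "A i \<subseteq> A n" if "i \<le> n" for i n
    using A(3) that by (simp add: incseq_def)
  have pA: "p \<in> A n" for n using A(4) mono[of 0 n] by auto
  have AD: "A n \<subseteq> D" for n using D by auto
  have oD: "open D" and cD: "connected D"
  proof -
    show "open D" using A(1) unfolding D by blast
    have "\<Inter> (range A) \<noteq> {}" using pA by blast
    then show "connected D" using A(2) unfolding D by (intro connected_Union) auto
  qed
  have fE: "f n holomorphic_on E n" "inj_on (f n) (E n)" "f n ` E n \<subseteq> unit_disc" for n
    using f(1)[of n] by (auto simp: univalent_maps_def)
  have "\<exists>g. g holomorphic_on f n ` E n \<and> (\<forall>z\<in>E n. g (f n z) = z)" for n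
    using holomorphic_has_inverse[OF fE(1) E(1) fE(2)] by metis
  then obtain g where g: "\<And>n. g n holomorphic_on f n ` E n" "\<And>n z. z \<in> E n \<Longrightarrow> g n (f n z) = z"
    by metis
  have gs: "g n holomorphic_on ball 0 s" for n
    using holomorphic_on_subset[OF g(1) f(3)] .
  have gw: "g n w \<in> E n" "f n (g n w) = w" if w: "w \<in> ball 0 s" for n w
  proof -
    obtain z where "z \<in> E n" "w = f n z" using f(3)[of n] w by blast
    then show "g n w \<in> E n" "f n (g n w) = w" using g(2) by auto
  qed
  have g0: "g n 0 = p" for n
    using g(2)[of p n] f(2) pA E(2) by auto
  obtain F r where r: "strict_mono (r :: nat \<Rightarrow> nat)" and F: "F holomorphic_on D"
    and Fl: "\<And>i K. compact K \<Longrightarrow> K \<subseteq> A i \<Longrightarrow> uniform_limit K (f \<circ> r) F sequentially"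
  proof (rule Montel_exhaustion[OF A(1,3), of f 1])
    show "f n holomorphic_on A n" for n using holomorphic_on_subset[OF fE(1) E(2)] .
    show "cmod (f n z) \<le> 1" if "z \<in> A n" for n z
      using fE(3)[of n] E(2)[of n] that by force
  qed (use D in auto)
  obtain h k where h: "h holomorphic_on ball 0 s" and k: "strict_mono (k :: nat \<Rightarrow> nat)"
    and hp: "\<And>x. x \<in> ball 0 s \<Longrightarrow> (\<lambda>n. g (r (k n)) x) \<longlonglongrightarrow> h x"
    and hl: "\<And>K. compact K \<Longrightarrow> K \<subseteq> ball 0 s \<Longrightarrow> uniform_limit K ((\<lambda>n. g (r n)) \<circ> k) h sequentially"
  proof (rule Montel[of "ball 0 s" "range g" "\<lambda>n. g (r n)"])
    show "\<exists>B. \<forall>h\<in>range g. \<forall>z\<in>K. cmod (h z) \<le> B" if "K \<subseteq> ball 0 s" for K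
    proof (intro exI[of _ 1] ballI)
      fix h z assume "h \<in> range g" "z \<in> K"
      then have "h z \<in> unit_disc" using gw(1) E(3) D(2) that by blast
      then show "cmod (h z) \<le> 1" by simp
    qed
  qed (use gs in auto)
  \<comment> \<open>\<open>r\<close> makes the maps converge and \<open>k\<close> refines it for the
    inverses, so both converge along \<open>q\<close>.\<close>
  define q where "q = r \<circ> k"
  have q: "strict_mono q" using r k by (simp add: q_def strict_mono_o)
  have qn: "n \<le> q n" for n using seq_suble[OF q] .
  have Fq: "uniform_limit K (\<lambda>n. f (q n)) F sequentially" if "compact K" "K \<subseteq> A i" for i K
    using filterlim_compose[OF Fl[OF that] filterlim_subseq[OF k]] by (simp add: q_def comp_def)
  have Fp: "F p = 0"
    using tendsto_uniform_limitI[OF Fq[of "{p}" 0], of p] f(2) pA by (simp add: LIMSEQ_const_iff)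
  have h0: "h 0 = p"
    using hp[of 0] s g0 by (simp add: LIMSEQ_const_iff)
  \<comment> \<open>\<open>F\<close> is a limit only on \<open>D\<close>, so \<open>h w\<close> must
    be known to lie there; \<open>near\<close> supplies such points before \<open>hD\<close>
    supplies all of them.\<close>
  have inv: "F (h w) = w" if w: "w \<in> ball 0 s" and hw: "h w \<in> D" for w
  proof -
    obtain i where i: "h w \<in> A i" using hw D by auto
    have "(\<lambda>n. f (q n) (g (q n) w)) \<longlonglongrightarrow> F (h w)"
    proof (rule uniform_limit_tendsto_compose[OF A(1) i, of F "\<lambda>n. g (q n) w" "\<lambda>n. f (q n)"])
      show "continuous_on (A i) F"
        using holomorphic_on_imp_continuous_on[OF holomorphic_on_subset[OF F AD]] .
      show "(\<lambda>n. g (q n) w) \<longlonglongrightarrow> h w" using hp[OF w] by (simp add: q_def)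
    qed (rule Fq)
    then show ?thesis using gw(2)[OF w] by (simp add: LIMSEQ_const_iff)
  qed
  \<comment> \<open>By continuity and \<open>h 0 = p\<close>, \<open>h\<close> maps a small ball
    about 0 into \<open>A i\<close>. A nonzero \<open>w\<close> there has
    \<open>F (h w) = w\<close>, which rules out constancy of \<open>F\<close> and of
    \<open>h\<close>.\<close>
  have near: "\<exists>w \<in> ball 0 s. w \<noteq> 0 \<and> h w \<in> A i" for i
  proof -
    have "open (ball 0 s \<inter> h -` A i)"
      by (rule continuous_open_preimage[OF holomorphic_on_imp_continuous_on[OF h] open_ball A(1)])
    moreover have "0 \<in> ball 0 s \<inter> h -` A i" using h0 pA s by simp
    ultimately obtain e where e: "e > 0" "ball 0 e \<subseteq> ball 0 s \<inter> h -` A i"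
      using open_contains_ball by blast
    have "of_real (e / 2) \<in> ball (0::complex) e" "of_real (e / 2) \<noteq> (0::complex)"
      using e(1) by simp_all
    then show ?thesis using e(2) by blast
  qed
  have Fnc: "\<not> F constant_on A i" for i
  proof
    assume "F constant_on A i"
    then have "F z = 0" if "z \<in> A i" for z
      using Fp pA[of i] that by (metis constant_on_def)
    moreover obtain w where "w \<in> ball 0 s" "w \<noteq> 0" "h w \<in> A i" using near by blast
    ultimately show False using inv AD by (metis in_mono)
  qed
  have hnc: "\<not> h constant_on ball 0 s"
  proof
    assume "h constant_on ball 0 s"
    then have hc: "h w = p" if "w \<in> ball 0 s" for w
      using h0 s that by (metis constant_on_def centre_in_ball)
    obtain w where "w \<in> ball 0 s" "w \<noteq> 0" "h w \<in> A 0" using near by blast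
    then show False using inv[of w] hc[of w] Fp AD by auto
  qed
  \<comment> \<open>A value outside \<open>D\<close> is omitted by every \<open>g (q n)\<close>,
    hence by Hurwitz also by the nonconstant limit \<open>h\<close>, which nevertheless takes it at
    \<open>w\<close>.\<close>
  have hD: "h w \<in> D" if w: "w \<in> ball 0 s" for w
  proof (rule ccontr)
    assume nD: "h w \<notin> D"
    have "h w - h w \<noteq> 0"
    proof (rule Hurwitz_no_zeros[of "ball 0 s" "\<lambda>n z. g (q n) z - h w" "\<lambda>z. h z - h w"])
      show "uniform_limit K (\<lambda>n z. g (q n) z - h w) (\<lambda>z. h z - h w) sequentially"
        if "compact K" "K \<subseteq> ball 0 s" for K
        using hl[OF that] by (intro uniform_limit_intros) (simp add: q_def comp_def)
      show "\<not> (\<lambda>z. h z - h w) constant_on ball 0 s"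
        using hnc unfolding constant_on_def by (metis diff_add_cancel)
      show "g (q n) z - h w \<noteq> 0" if "z \<in> ball 0 s" for n z
        using gw(1)[OF that, of "q n"] E(3)[of "q n"] nD by auto
    qed (use gs h w in \<open>auto intro!: holomorphic_intros\<close>)
    then show False by simp
  qed
  have "ball 0 s \<subseteq> F ` D"
    using inv hD by (metis imageI subsetI)
  moreover have "F ` D \<subseteq> unit_disc"
  \<comment> \<open>Limits of points of the open disc lie a priori only in the closed disc; openness
    of the image restores strictness.\<close>
  proof (rule holomorphic_image_in_open_disc[OF F oD cD])
    show "\<not> F constant_on D" using Fnc[of 0] AD constant_on_subset by blast
    show "F ` D \<subseteq> cball 0 1"
    proof
      fix y assume "y \<in> F ` D"
      then obtain z i where z: "z \<in> A i" "y = F z" using D by auto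
      have "(\<lambda>n. f (q n) z) \<longlonglongrightarrow> F z"
        using tendsto_uniform_limitI[OF Fq[of "{z}" i], of z] z by simp
      moreover have "\<forall>\<^sub>F n in sequentially. f (q n) z \<in> cball 0 1"
        using eventually_ge_at_top[of i]
      proof eventually_elim
        case (elim n)
        have "i \<le> q n" using qn[of n] elim by linarith
        then have "z \<in> E (q n)" using mono z E(2) by blast
        then show ?case using fE(3)[of "q n"] by force
      qed
      ultimately show "y \<in> cball 0 1"
        using z Lim_in_closed_set[OF closed_cball] trivial_limit_sequentially by metis
    qed
  qed
  moreover have "inj_on F D"
  proof (rule inj_onI)
    fix x y assume xy: "x \<in> D" "y \<in> D" "F x = F y"
    obtain i j where "x \<in> A i" "y \<in> A j" using xy D by auto
    then have xyA: "x \<in> A (max i j)" "y \<in> A (max i j)" using mono by (meson max.cobounded1 max.cobounded2 subsetD)+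
    define m where "m = max i j"
    \<comment> \<open>The shift by \<open>m\<close> makes every map of the sequence defined and
      injective on \<open>A m\<close>, as Hurwitz's theorem for injectivity requires.\<close>
    have sub: "A m \<subseteq> E (q (n + m))" for n
      using mono[of m "q (n + m)"] qn[of "n + m"] E(2)[of "q (n + m)"] by (meson le_add2 order_trans)
    have "inj_on F (A m)"
    proof (rule Hurwitz_injective[of "A m" "\<lambda>n. f (q (n + m))"])
      show "uniform_limit K (\<lambda>n. f (q (n + m))) F sequentially" if "compact K" "K \<subseteq> A m" for K
        using filterlim_compose[OF Fq[OF that] filterlim_add_const_nat_at_top[of m]] by simp
      show "f (q (n + m)) holomorphic_on A m" "inj_on (f (q (n + m))) (A m)" for n
        using fE sub by (meson holomorphic_on_subset inj_on_subset)+
    qed (use A F AD Fnc holomorphic_on_subset in blast)+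
    then show "x = y" using xyA xy(3) by (simp add: m_def inj_on_def)
  qed
  ultimately show ?thesis
    using F Fp by (auto simp: univalent_maps_def)
qed

section \<open>Bounds for the two invariants\<close>

lemma squeezing_function_upperI:
  assumes "f \<in> univalent_maps D unit_disc" "f z = 0" "ball 0 r \<subseteq> f ` D" "r > 0"
  shows "r \<le> squeezing_function D z"
  unfolding squeezing_function_def
proof (rule cSup_upper)
  show "bdd_above {r. r > 0 \<and> (\<exists>f \<in> univalent_maps D unit_disc. f z = 0 \<and> ball 0 r \<subseteq> f ` D)}"
  proof (rule bdd_aboveI[of _ 1])
    fix x assume "x \<in> {r. r > 0 \<and> (\<exists>f \<in> univalent_maps D unit_disc. f z = 0 \<and> ball 0 r \<subseteq> f ` D)}"
    then have "ball (0::complex) x \<subseteq> ball 0 1" by (auto simp: univalent_maps_def)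
    then show "x \<le> 1" by (auto simp: ball_subset_ball_iff)
  qed
qed (use assms in blast)

text \<open>The affine map \<open>(w - z) / 2\<close> is a competitor, so the supremum is over a
  nonempty set.\<close>

lemma squeezing_function_leI:
  assumes D: "open D" "D \<subseteq> unit_disc" "z \<in> D"
    and le: "\<And>f r. f \<in> univalent_maps D unit_disc \<Longrightarrow> f z = 0 \<Longrightarrow> ball 0 r \<subseteq> f ` D \<Longrightarrow> r > 0 \<Longrightarrow> r \<le> c"
  shows "squeezing_function D z \<le> c"
  unfolding squeezing_function_def
proof (rule cSup_least)
  obtain e where e: "e > 0" "ball z e \<subseteq> D"
    using D open_contains_ball by blast
  let ?f = "\<lambda>w. (w - z) / 2"
  have "?f \<in> univalent_maps D unit_disc"
  proof -
    have "cmod (w - z) < 2" if "w \<in> D" for w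
    proof -
      have "w \<in> unit_disc" "z \<in> unit_disc" using D that by auto
      then show ?thesis using norm_triangle_ineq4[of w z] by simp
    qed
    then show ?thesis
      by (auto simp: univalent_maps_def inj_on_def norm_divide intro!: holomorphic_intros)
  qed
  moreover have "ball 0 (e / 2) \<subseteq> ?f ` D"
  proof
    fix y assume "y \<in> ball (0::complex) (e / 2)"
    then have "z + 2 * y \<in> D" using e by (intro subsetD[OF e(2)]) (simp add: dist_norm norm_mult)
    then show "y \<in> ?f ` D" by (intro image_eqI[of _ _ "z + 2 * y"]) auto
  qed
  ultimately show "{r. r > 0 \<and> (\<exists>f \<in> univalent_maps D unit_disc. f z = 0 \<and> ball 0 r \<subseteq> f ` D)} \<noteq> {}"
    using e(1) half_gt_zero by (metis (mono_tags, lifting) diff_self div_0 empty_Collect_eq)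
qed (use le in blast)

lemma fridman_invariant_upperI:
  assumes "f \<in> univalent_maps unit_disc D" "f 0 = z" "kobayashi_ball D z R \<subseteq> f ` unit_disc" "R > 0"
  shows "tanh R \<le> fridman_invariant D z"
  unfolding fridman_invariant_def
proof (rule cSup_upper)
  show "bdd_above {tanh r | r. r > 0 \<and> (\<exists>f \<in> univalent_maps unit_disc D. f 0 = z \<and>
      kobayashi_ball D z r \<subseteq> f ` unit_disc)}"
    by (rule bdd_aboveI[of _ 1]) (auto intro: less_imp_le tanh_real_lt_1)
qed (use assms in blast)

text \<open>The competitor is the affine map onto a Euclidean ball of radius \<open>e\<close>; the
  constant 4 of \<open>dist_le_disc_dist\<close> explains the Kobayashi radius
  \<open>e / 4\<close>.\<close>

lemma fridman_set_nonempty: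
  assumes D: "open D" "connected D" "D \<subseteq> unit_disc" "z \<in> D"
  shows "\<exists>R>0. \<exists>f \<in> univalent_maps unit_disc D. f 0 = z \<and> kobayashi_ball D z R \<subseteq> f ` unit_disc"
proof -
  obtain e where e: "e > 0" "ball z e \<subseteq> D"
    using D open_contains_ball by blast
  let ?f = "\<lambda>w. z + of_real e * w"
  have im: "?f ` unit_disc = ball z e"
  proof
    show "?f ` unit_disc \<subseteq> ball z e"
      using e(1) by (auto simp: dist_norm norm_mult)
    show "ball z e \<subseteq> ?f ` unit_disc"
    proof
      fix w assume "w \<in> ball z e"
      then have "(w - z) / of_real e \<in> unit_disc"
        using e(1) by (simp add: norm_divide dist_norm norm_minus_commute)
      then show "w \<in> ?f ` unit_disc"
        using e(1) by (intro image_eqI[of _ _ "(w - z) / of_real e"]) auto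
    qed
  qed
  have "?f \<in> univalent_maps unit_disc D"
    using e im by (auto simp: univalent_maps_def inj_on_def intro!: holomorphic_intros)
  moreover have "kobayashi_ball D z (e / 4) \<subseteq> ball z e"
  proof
    fix w assume w: "w \<in> kobayashi_ball D z (e / 4)"
    have "dist z w < 4 * (e / 4)"
    proof (rule kobayashi_ball_dist_less[OF _ D(1,2,4) _ w, of "\<lambda>x. x" 4])
      show "dist (\<phi> a) (\<phi> b) \<le> 4 * disc_dist a b"
        if "\<phi> holomorphic_on unit_disc" "\<phi> ` unit_disc \<subseteq> D" "a \<in> unit_disc" "b \<in> unit_disc" for \<phi> a b
        by (rule dist_le_disc_dist[OF that(1) order_trans[OF that(2) D(3)] that(3,4)])
    qed simp
    then show "w \<in> ball z e" by simp
  qed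
  ultimately show ?thesis
    using e(1) im by (intro exI[of _ "e / 4"] conjI bexI[of _ ?f]) auto
qed

lemma less_fridman_invariantD:
  assumes D: "open D" "connected D" "D \<subseteq> unit_disc" "z \<in> D" and c: "c < fridman_invariant D z"
  obtains f R where "R > 0" "c < tanh R" "f \<in> univalent_maps unit_disc D" "f 0 = z"
    "kobayashi_ball D z R \<subseteq> f ` unit_disc"
proof -
  have "{tanh r | r. r > 0 \<and> (\<exists>f \<in> univalent_maps unit_disc D. f 0 = z \<and>
      kobayashi_ball D z r \<subseteq> f ` unit_disc)} \<noteq> {}"
    using fridman_set_nonempty[OF D] by blast
  from less_cSupD[OF this c[unfolded fridman_invariant_def]] that show ?thesis
    by blast
qed

text \<open>A limit point \<open>v\<close> is reached from nearby points \<open>w\<close> of the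
  ball by one more disc, whose length tends to 0 and so drops below \<open>R - R'\<close>.\<close>

lemma closure_kobayashi_ball_subset:
  assumes D: "open D" "connected D" "z \<in> D" and R: "R' < R" and cl: "closure (kobayashi_ball D z R') \<subseteq> D"
  shows "closure (kobayashi_ball D z R') \<subseteq> kobayashi_ball D z R"
proof
  fix v assume v: "v \<in> closure (kobayashi_ball D z R')"
  then have vD: "v \<in> D" using cl by blast
  obtain e where e: "e > 0" "ball v e \<subseteq> D"
    using D(1) vD open_contains_ball by blast
  have "((\<lambda>x. artanh (x / e)) \<longlongrightarrow> artanh (0 / e)) (at_right 0)"
    using e(1) by (intro tendsto_intros) auto
  then have "\<forall>\<^sub>F x in at_right 0. artanh (x / e) < R - R'"
    using R by (intro order_tendstoD(2)[of _ "artanh (0 / e)"]) auto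
  moreover have "\<forall>\<^sub>F x in at_right 0. x < e"
    using e(1) by (rule eventually_at_right_real[THEN eventually_mono]) auto
  ultimately have "\<forall>\<^sub>F x in at_right 0. artanh (x / e) < R - R' \<and> x < e"
    by eventually_elim simp
  then obtain d where d: "d > 0" "\<And>x. 0 < x \<Longrightarrow> x < d \<Longrightarrow> artanh (x / e) < R - R' \<and> x < e"
    unfolding eventually_at_right_field by blast
  obtain w where w: "w \<in> kobayashi_ball D z R'" "dist w v < min d e"
    using v d(1) e(1) closure_approachable[of v] by (metis min_less_iff_conj)
  \<comment> \<open>The choice of \<open>d\<close> concerns positive distances only;
    \<open>w = v\<close> is treated apart.\<close>
  have "artanh (dist w v / e) < R - R'"
    using d(2)[of "dist w v"] w(2) R by (cases "w = v") auto
  moreover have "kobayashi_dist D z v \<le> kobayashi_dist D z w + artanh (dist w v / e)"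
    using w(2) by (intro kobayashi_dist_triangle_ball[OF D e(2)]) (simp add: dist_commute)
  ultimately show "v \<in> kobayashi_ball D z R"
    using w(1) vD by (simp add: kobayashi_ball_def)
qed

lemma kobayashi_ball_in_smaller_disc_image:
  assumes D: "open D" "connected D" "bounded D" "z \<in> D" and R: "R' < R"
    and cl: "closure (kobayashi_ball D z R') \<subseteq> D"
    and f: "f \<in> univalent_maps unit_disc D" "kobayashi_ball D z R \<subseteq> f ` unit_disc"
  obtains t where "0 < t" "t < 1" "kobayashi_ball D z R' \<subseteq> f ` ball 0 t"
proof -
  define K where "K = closure (kobayashi_ball D z R')"
  have KD: "K \<subseteq> f ` unit_disc"
    using closure_kobayashi_ball_subset[OF D(1,2,4) R cl] f(2) by (simp add: K_def)
  have "compact K"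
    using D(3) cl unfolding K_def by (metis bounded_subset closed_closure compact_eq_bounded_closed)
  \<comment> \<open>The offset 2 keeps every radius strictly between 0 and 1.\<close>
  define U where "U n = f ` ball 0 (1 - 1 / real (n + 2))" for n
  have U1: "1 - 1 / real (n + 2) < 1" "0 < 1 - 1 / real (n + 2)" for n
    by (auto simp: field_simps)
  have "open (U n)" for n
  proof -
    have "ball 0 (1 - 1 / real (n + 2)) \<subseteq> (unit_disc :: complex set)"
      using U1(1)[of n] by (simp add: ball_subset_ball_iff)
    then show ?thesis
      unfolding U_def using f(1)
      by (intro open_mapping_thm3[OF holomorphic_on_subset _ inj_on_subset])
         (auto simp: univalent_maps_def)
  qed
  moreover have "K \<subseteq> (\<Union>n. U n)"
  proof
    fix y assume "y \<in> K"
    then obtain x where x: "cmod x < 1" "y = f x" using KD by auto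
    obtain n where "inverse (real (Suc n)) < 1 - cmod x"
      using reals_Archimedean[of "1 - cmod x"] x(1) by auto
    moreover have "1 / real (n + 2) \<le> inverse (real (Suc n))" by (simp add: field_simps)
    ultimately have "x \<in> ball 0 (1 - 1 / real (n + 2))" by simp
    then show "y \<in> (\<Union>n. U n)" using x(2) unfolding U_def by blast
  qed
  ultimately obtain N where N: "finite N" "K \<subseteq> (\<Union>n\<in>N. U n)"
    using compactE_image[OF \<open>compact K\<close>, of UNIV U] by auto
  \<comment> \<open>Inserting 0 keeps \<open>Max\<close> meaningful if \<open>N\<close> is
    empty.\<close>
  define m where "m = Max (insert 0 N)"
  have "U n \<subseteq> U m" if "n \<in> N" for n
  proof -
    have "n \<le> m" using that N(1) by (simp add: m_def)
    then have "1 - 1 / real (n + 2) \<le> 1 - 1 / real (m + 2)" by (simp add: field_simps)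
    then show ?thesis unfolding U_def by (intro image_mono subset_ball)
  qed
  then have "kobayashi_ball D z R' \<subseteq> U m"
    using N(2) closure_subset[of "kobayashi_ball D z R'"] unfolding K_def by blast
  then show ?thesis
    using that[OF U1(2,1)] by (simp add: U_def)
qed

section \<open>The punctured disc and its annuli\<close>

lemma punctured_disc_eq: "punctured_disc = unit_disc - {0}"
  by (auto simp: punctured_disc_def)

lemma open_punctured_disc: "open punctured_disc"
  by (simp add: punctured_disc_eq open_delete)

lemma connected_punctured_disc: "connected punctured_disc"
  by (simp add: punctured_disc_eq connected_punctured_ball)

lemma punctured_disc_subset: "punctured_disc \<subseteq> unit_disc"
  by (simp add: punctured_disc_eq)

lemma open_annulus: "open (annulus r)"
proof -
  have "annulus r = ball 0 1 - cball 0 r" by (auto simp: annulus_def)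
  then show ?thesis by (simp add: open_Diff)
qed

lemma connected_annulus_0: "connected (annulus r)"
  using connected_annulus(1)[of r "0::complex" 1] by (simp add: annulus_def)

lemma annulus_antimono: "r \<le> s \<Longrightarrow> annulus s \<subseteq> annulus r"
  by (auto simp: annulus_def)

lemma annulus_subset_punctured_disc: "0 \<le> r \<Longrightarrow> annulus r \<subseteq> punctured_disc"
  by (auto simp: annulus_def punctured_disc_def)

text \<open>On the ball, \<open>ln (- ln (cmod w))\<close> differs from its value at
  \<open>z\<close> by less than \<open>2 * R\<close>; this confines the ball to a closed ring away
  from 0 and from the unit circle.\<close>

lemma closure_kobayashi_ball_punctured_disc:
  assumes z: "z \<in> punctured_disc"
  shows "closure (kobayashi_ball punctured_disc z R) \<subseteq> punctured_disc"
proof -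
  define u where "u w = ln (- ln (cmod w))" for w :: complex
  \<comment> \<open>Since \<open>cmod w = exp (- exp (u w))\<close> decreases in \<open>u w\<close>,
    the upper bound on \<open>u\<close> gives the inner radius \<open>p\<close>.\<close>
  define p q where "p = exp (- exp (u z + 2 * R))" and "q = exp (- exp (u z - 2 * R))"
  have "kobayashi_ball punctured_disc z R \<subseteq> {w. p \<le> cmod w \<and> cmod w \<le> q}"
  proof
    fix w assume w: "w \<in> kobayashi_ball punctured_disc z R"
    have "dist (u z) (u w) < 2 * R"
      unfolding u_def
      by (rule kobayashi_ball_dist_less[OF dist_ln_ln_le_disc_dist open_punctured_disc
            connected_punctured_disc z _ w]) auto
    then have uw: "u w \<le> u z + 2 * R" "u z - 2 * R \<le> u w"
      by (auto simp: dist_real_def)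
    have w01: "0 < cmod w" "cmod w < 1"
      using w by (auto simp: kobayashi_ball_def punctured_disc_def)
    have "cmod w = exp (- exp (u w))"
      using w01 by (simp add: u_def)
    then show "w \<in> {w. p \<le> cmod w \<and> cmod w \<le> q}"
      using uw by (simp add: p_def q_def)
  qed
  moreover have "closed {w::complex. p \<le> cmod w \<and> cmod w \<le> q}"
    by (intro closed_Collect_conj closed_Collect_le continuous_intros)
  ultimately have "closure (kobayashi_ball punctured_disc z R) \<subseteq> {w. p \<le> cmod w \<and> cmod w \<le> q}"
    by (rule closure_minimal)
  also have "\<dots> \<subseteq> punctured_disc"
  proof -
    have "0 < p" "q < 1" by (simp_all add: p_def q_def)
    then show ?thesis by (auto simp: punctured_disc_def)
  qed
  finally show ?thesis .
qed

lemma fridman_invariant_annulus_ge: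
  assumes z: "z \<in> punctured_disc" and R: "0 < R'" "R' < R"
    and f: "f \<in> univalent_maps unit_disc punctured_disc" "f 0 = z"
      "kobayashi_ball punctured_disc z R \<subseteq> f ` unit_disc"
  shows "\<exists>\<epsilon>>0. \<forall>r. 0 < r \<and> r < \<epsilon> \<longrightarrow> tanh R' \<le> fridman_invariant (annulus r) z"
proof -
  have "bounded punctured_disc"
    using bounded_subset[OF bounded_ball punctured_disc_subset] .
  then obtain t where t: "0 < t" "t < 1" "kobayashi_ball punctured_disc z R' \<subseteq> f ` ball 0 t"
    using kobayashi_ball_in_smaller_disc_image[OF open_punctured_disc connected_punctured_disc _ z R(2)
        closure_kobayashi_ball_punctured_disc[OF z] f(1,3)] by blast
  have fhol: "f holomorphic_on unit_disc" "inj_on f unit_disc" "f ` unit_disc \<subseteq> punctured_disc"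
    using f(1) by (auto simp: univalent_maps_def)
  have sub: "cball 0 t \<subseteq> (unit_disc :: complex set)" using t by auto
  have "continuous_on (cball 0 t) (\<lambda>x. cmod (f x))"
    using holomorphic_on_imp_continuous_on[OF holomorphic_on_subset[OF fhol(1) sub]]
    by (intro continuous_intros)
  moreover have "cball 0 t \<noteq> ({} :: complex set)" using t(1) by auto
  \<comment> \<open>The minimum of \<open>cmod (f y)\<close> over the compact disc is positive
    because \<open>f\<close> omits 0; it serves as \<epsilon>.\<close>
  ultimately obtain x where x: "x \<in> cball 0 t" "\<And>y. y \<in> cball 0 t \<Longrightarrow> cmod (f x) \<le> cmod (f y)"
    using continuous_attains_inf[OF compact_cball, of 0 t "\<lambda>x. cmod (f x)"] by blast
  define g where "g w = f (of_real t * w)" for w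
  have gim: "g ` unit_disc = f ` ball 0 t"
  proof -
    have "(\<lambda>w. of_real t * w) ` unit_disc = ball (0::complex) t"
      using ball_scale[of t "0::complex" 1] t(1) by (simp add: scaleR_conv_of_real)
    then show ?thesis unfolding g_def image_image[symmetric] by simp
  qed
  show ?thesis
  proof (intro exI conjI allI impI)
    show "0 < cmod (f x)" using x(1) sub fhol(3) by (force simp: punctured_disc_def)
    fix r assume r: "0 < r \<and> r < cmod (f x)"
    have im: "f ` ball 0 t \<subseteq> annulus r"
    proof
      fix v assume "v \<in> f ` ball 0 t"
      then obtain y where y: "y \<in> ball 0 t" "v = f y" by blast
      then have yc: "y \<in> cball 0 t" by auto
      then have "v \<in> punctured_disc" using y fhol(3) sub by blast
      then show "v \<in> annulus r" using r x(2)[OF yc] y(2) by (auto simp: annulus_def punctured_disc_def)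
    qed
    have za: "z \<in> annulus r" using im f(2) t(1) by force
    have "g \<in> univalent_maps unit_disc (annulus r)"
    proof -
      have sc: "of_real t * w \<in> unit_disc" if "w \<in> unit_disc" for w :: complex
      proof -
        have "cmod (of_real t * w) \<le> cmod w" using t by (simp add: norm_mult mult_left_le_one_le)
        then show ?thesis using that by simp
      qed
      have "g holomorphic_on unit_disc"
        unfolding g_def
        by (rule holomorphic_on_compose_gen[OF _ fhol(1), unfolded o_def]) (use sc in \<open>auto intro!: holomorphic_intros\<close>)
      moreover have "inj_on g unit_disc"
        using inj_onD[OF fhol(2) _ sc sc] t(1) by (auto simp: inj_on_def g_def)
      ultimately show ?thesis using gim im by (simp add: univalent_maps_def)
    qed
    moreover have "kobayashi_ball (annulus r) z R' \<subseteq> g ` unit_disc"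
      using kobayashi_ball_mono[OF annulus_subset_punctured_disc open_annulus connected_annulus_0 za] r t(3) gim
      by force
    ultimately show "tanh R' \<le> fridman_invariant (annulus r) z"
      using R(1) f(2) by (intro fridman_invariant_upperI[of g]) (auto simp: g_def)
  qed
qed

text \<open>Otherwise competitors covering \<open>ball 0 c\<close> exist for arbitrarily small inner
  radii, and \<open>univalent_limit\<close> yields one on the punctured disc, contradicting the
  choice of \<open>c\<close>.\<close>

lemma squeezing_function_annulus_le:
  assumes z: "z \<in> punctured_disc" and c: "squeezing_function punctured_disc z < c" "0 < c"
  shows "\<exists>\<epsilon>>0. \<forall>r. 0 < r \<and> r < \<epsilon> \<longrightarrow> squeezing_function (annulus r) z \<le> c"
proof (rule ccontr)
  assume contra: "\<not> ?thesis"
  have zp: "0 < cmod z" "cmod z < 1" using z by (auto simp: punctured_disc_def)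
  \<comment> \<open>These radii decrease to 0 and, thanks to the offset 2, lie below
    \<open>cmod z\<close> from the start, so every annulus contains \<open>z\<close>.\<close>
  define d where "d n = cmod z / real (n + 2)" for n :: nat
  have dp: "0 < d n" "d n < cmod z" for n
    using zp(1) by (auto simp: d_def field_simps intro: add_pos_nonneg)
  have dec: "d n \<le> d m" if "m \<le> n" for m n
    using that zp(1) by (simp add: d_def frac_le)
  have "\<exists>r f. 0 < r \<and> r < d n \<and> f \<in> univalent_maps (annulus r) unit_disc \<and> f z = 0 \<and> ball 0 c \<subseteq> f ` annulus r" for n
  proof -
    obtain r where r: "0 < r" "r < d n" "\<not> squeezing_function (annulus r) z \<le> c"
      using contra dp(1)[of n] by blast
    have za: "z \<in> annulus r" using r(2) dp(2)[of n] zp by (simp add: annulus_def)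
    have "annulus r \<subseteq> unit_disc" by (auto simp: annulus_def)
    from squeezing_function_leI[OF open_annulus this za, of c] r(3)
    obtain f s where "f \<in> univalent_maps (annulus r) unit_disc" "f z = 0" "ball 0 s \<subseteq> f ` annulus r" "\<not> s \<le> c"
      by blast
    moreover from this have "ball 0 c \<subseteq> f ` annulus r"
      using subset_ball[of c s "0::complex"] by (meson linear order_trans)
    ultimately show ?thesis using r by blast
  qed
  then obtain \<rho> f where \<rho>: "\<And>n. 0 < \<rho> n" "\<And>n. \<rho> n < d n"
    and f: "\<And>n. f n \<in> univalent_maps (annulus (\<rho> n)) unit_disc" "\<And>n. f n z = 0"
      "\<And>n. ball 0 c \<subseteq> f n ` annulus (\<rho> n)"
    by metis
  have "\<exists>F \<in> univalent_maps punctured_disc unit_disc. F z = 0 \<and> ball 0 c \<subseteq> F ` punctured_disc"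
  \<comment> \<open>The radii \<open>\<rho> n\<close> need not be monotone; the exhaustion uses the
    \<open>d n\<close> instead, while the maps live on the larger annuli.\<close>
  proof (rule univalent_limit[of "\<lambda>n. annulus (d n)" z punctured_disc "\<lambda>n. annulus (\<rho> n)" f])
    show "incseq (\<lambda>n. annulus (d n))"
      using dec by (auto simp: incseq_def intro!: annulus_antimono)
    show "z \<in> annulus (d 0)" using dp(2) zp by (simp add: annulus_def)
    show "punctured_disc = (\<Union>n. annulus (d n))"
    proof
      show "punctured_disc \<subseteq> (\<Union>n. annulus (d n))"
      proof
        fix w assume w: "w \<in> punctured_disc"
        have "d \<longlonglongrightarrow> 0" unfolding d_def
          by (rule LIMSEQ_ignore_initial_segment[OF lim_const_over_n])
        then have "\<forall>\<^sub>F n in sequentially. d n < cmod w"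
          using w by (intro order_tendstoD(2)[of _ 0]) (auto simp: punctured_disc_def)
        then obtain n where "d n < cmod w"
          using eventually_happens'[OF sequentially_bot] by blast
        then show "w \<in> (\<Union>n. annulus (d n))" using w by (auto simp: annulus_def punctured_disc_def)
      qed
      show "(\<Union>n. annulus (d n)) \<subseteq> punctured_disc"
        using annulus_subset_punctured_disc dp(1) less_imp_le by blast
    qed
    show "annulus (d n) \<subseteq> annulus (\<rho> n)" for n
      using \<rho>(2)[of n] by (intro annulus_antimono) simp
    show "annulus (\<rho> n) \<subseteq> punctured_disc" for n
      using \<rho>(1)[of n] by (intro annulus_subset_punctured_disc) simp
  qed (use open_annulus connected_annulus_0 punctured_disc_subset f c in auto)
  then have "c \<le> squeezing_function punctured_disc z"
    using squeezing_function_upperI c(2) by blast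
  then show False using c(1) by simp
qed

theorem corollary7:
  fixes \<delta> :: real and z\<^sub>0 :: complex
  assumes "\<delta> > 0"
    and "\<And>z. z \<in> punctured_disc \<Longrightarrow> cmod z < \<delta> \<Longrightarrow> quotient_invariant punctured_disc z < 1"
    and "z\<^sub>0 \<in> punctured_disc" and "cmod z\<^sub>0 < \<delta>"
  shows "\<exists>\<epsilon>>0. \<epsilon> \<le> cmod z\<^sub>0 \<and>
           (\<forall>r. 0 < r \<and> r < \<epsilon> \<longrightarrow> quotient_invariant (annulus r) z\<^sub>0 < 1)"
proof -
  let ?P = "punctured_disc"
  note P = open_punctured_disc connected_punctured_disc punctured_disc_subset assms(3)
  have q: "quotient_invariant ?P z\<^sub>0 < 1" by (rule assms(2)[OF assms(3,4)])
  obtain R\<^sub>0 f\<^sub>0 where "R\<^sub>0 > 0" "f\<^sub>0 \<in> univalent_maps unit_disc ?P" "f\<^sub>0 0 = z\<^sub>0"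
    "kobayashi_ball ?P z\<^sub>0 R\<^sub>0 \<subseteq> f\<^sub>0 ` unit_disc"
    using fridman_set_nonempty[OF P] by blast
  then have "tanh R\<^sub>0 \<le> fridman_invariant ?P z\<^sub>0" "0 < tanh R\<^sub>0"
    using fridman_invariant_upperI by auto
  \<comment> \<open>Positivity lets the quotient be multiplied out; a zero denominator would make
    the quotient 0 and the bound empty.\<close>
  then have "0 < fridman_invariant ?P z\<^sub>0" by linarith
  then have "squeezing_function ?P z\<^sub>0 < fridman_invariant ?P z\<^sub>0"
    using q by (simp add: quotient_invariant_def divide_less_eq_1_pos)
  from less_fridman_invariantD[OF P this] obtain f R where R: "R > 0" "squeezing_function ?P z\<^sub>0 < tanh R"
    and f: "f \<in> univalent_maps unit_disc ?P" "f 0 = z\<^sub>0" "kobayashi_ball ?P z\<^sub>0 R \<subseteq> f ` unit_disc"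
    by blast
  \<comment> \<open>The loss of radius in \<open>fridman_invariant_annulus_ge\<close> is absorbed by
    continuity of \<open>tanh\<close>: some \<open>R' < R\<close> still beats the squeezing
    function.\<close>
  have "(tanh \<longlongrightarrow> tanh R) (at_left R)"
    by (intro tendsto_intros) auto
  then have "\<forall>\<^sub>F x in at_left R. squeezing_function ?P z\<^sub>0 < tanh x"
    using R(2) by (rule order_tendstoD(1))
  moreover have "\<forall>\<^sub>F x in at_left R. x \<in> {0<..<R}"
    using R(1) by (rule eventually_at_left_real)
  ultimately have "\<forall>\<^sub>F x in at_left R. squeezing_function ?P z\<^sub>0 < tanh x \<and> x \<in> {0<..<R}"
    by (rule eventually_conj)
  then obtain R' where R': "squeezing_function ?P z\<^sub>0 < tanh R'" "0 < R'" "R' < R"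
    using eventually_happens'[OF trivial_limit_at_left_real] by auto
  \<comment> \<open>The maximum with 0 makes \<open>c\<close> positive, hence a true radius for the
    limit argument.\<close>
  then have "max 0 (squeezing_function ?P z\<^sub>0) < tanh R'" by simp
  then obtain c where c: "0 < c" "squeezing_function ?P z\<^sub>0 < c" "c < tanh R'"
    using dense by (metis max_less_iff_conj)
  obtain \<epsilon>1 where \<epsilon>1: "\<epsilon>1 > 0" "\<And>r. 0 < r \<Longrightarrow> r < \<epsilon>1 \<Longrightarrow> tanh R' \<le> fridman_invariant (annulus r) z\<^sub>0"
    using fridman_invariant_annulus_ge[OF assms(3) R'(2,3) f] by blast
  obtain \<epsilon>2 where \<epsilon>2: "\<epsilon>2 > 0" "\<And>r. 0 < r \<Longrightarrow> r < \<epsilon>2 \<Longrightarrow> squeezing_function (annulus r) z\<^sub>0 \<le> c"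
    using squeezing_function_annulus_le[OF assms(3) c(2,1)] by blast
  show ?thesis
  \<comment> \<open>Below \<epsilon>1 and \<epsilon>2 the numerator is at most \<open>c\<close> and
    the denominator at least \<open>tanh R' > c\<close>; the entry \<open>cmod z\<^sub>0\<close>
    gives the required upper bound on \<epsilon>.\<close>
  proof (intro exI[of _ "min (cmod z\<^sub>0) (min \<epsilon>1 \<epsilon>2)"] conjI allI impI)
    show "0 < min (cmod z\<^sub>0) (min \<epsilon>1 \<epsilon>2)"
      using assms(3) \<epsilon>1(1) \<epsilon>2(1) by (simp add: punctured_disc_def)
    fix r assume "0 < r \<and> r < min (cmod z\<^sub>0) (min \<epsilon>1 \<epsilon>2)"
    then have "tanh R' \<le> fridman_invariant (annulus r) z\<^sub>0" "squeezing_function (annulus r) z\<^sub>0 \<le> c"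
      using \<epsilon>1(2) \<epsilon>2(2) by auto
    then show "quotient_invariant (annulus r) z\<^sub>0 < 1"
      using c by (simp add: quotient_invariant_def)
  qed simp
qed

end
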